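(* Let $b\in\mathbb R^n$, let $S(b)=\{z\in\mathbb R^n: z\ge b\}$, and let $F:S(b)\to S(b)$ be isotonic. If the set $\mathrm{Low}(F)=\{z\in S(b): z\le F(z)\}$ is bounded, then it has a largest element $\bar z$, and $F$ has at least one fixpoint. Moreover $\bar z$ is also the largest fixpoint of $F$.
   Context: Comparison of vectors in $\mathbb R^n$ is coordinatewise. $F$ is isotonic if $z\le z'$ implies $F(z)\le F(z')$ for all $z,z'\in S(b)$. A fixpoint of $F$ is a (finite) $z\in S(b)$ with $F(z)=z$. *)

theory Defs
  imports "HOL-Analysis.Analysis"
begin

text \<open>The library order on \<^typ>\<open>real ^ 'n\<close> is the coordinatewise one.\<close>

definition S :: "real ^ 'n \<Rightarrow> (real ^ 'n) set" where
  "S b = {z. z \<ge> b}"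

definition Low :: "real ^ 'n \<Rightarrow> (real ^ 'n \<Rightarrow> real ^ 'n) \<Rightarrow> (real ^ 'n) set" where
  "Low b F = {z \<in> S b. z \<le> F z}"

definition Fixpoints :: "real ^ 'n \<Rightarrow> (real ^ 'n \<Rightarrow> real ^ 'n) \<Rightarrow> (real ^ 'n) set" where
  "Fixpoints b F = {z \<in> S b. F z = z}"

definition is_largest :: "'a::order \<Rightarrow> 'a set \<Rightarrow> bool" where
  "is_largest x A \<longleftrightarrow> x \<in> A \<and> (\<forall>y\<in>A. y \<le> x)"

end

theory Submission
  imports Defs
begin

text \<open>This is the Knaster-Tarski argument. By \<open>bounded_imp_componentwise_lub\<close>,
  the nonempty bounded set \<open>Low b F\<close> has a least upper bound \<open>s\<close>.
  Isotonicity makes \<open>F s\<close> an upper bound too, so \<open>s \<le> F s\<close>; applying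
  \<open>F\<close> once more puts \<open>F s\<close> into \<open>Low b F\<close>, so
  \<open>F s \<le> s\<close>. Thus \<open>s\<close> is a fixpoint, and it dominates all others
  because fixpoints lie in \<open>Low b F\<close>.\<close>

lemma bounded_imp_componentwise_lub:
  fixes A :: "(real ^ 'n) set"
  assumes "bounded A" and "A \<noteq> {}"
  obtains s where "\<And>z. z \<in> A \<Longrightarrow> z \<le> s" and "\<And>u. (\<And>z. z \<in> A \<Longrightarrow> z \<le> u) \<Longrightarrow> s \<le> u"
proof -
  \<comment> \<open>Each coordinate is a supremum in the conditionally complete order of the reals,
    meaningful because \<open>A\<close> is nonempty and its projections are bounded above.\<close>
  define s :: "real ^ 'n" where "s = (\<chi> i. SUP z\<in>A. z $ i)"
  have bdd: "bdd_above ((\<lambda>z. z $ i) ` A)" for i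
    using assms(1) by (intro bounded_imp_bdd_above bounded_component_cart)
  have "z \<le> s" if "z \<in> A" for z
    using that by (auto simp: less_eq_vec_def s_def intro!: cSUP_upper bdd)
  moreover have "s \<le> u" if "\<And>z. z \<in> A \<Longrightarrow> z \<le> u" for u
    using that assms(2) by (auto simp: less_eq_vec_def s_def intro!: cSUP_least)
  ultimately show thesis
    using that by blast
qed

theorem theorem6:
  fixes b :: "real ^ 'n" and F :: "real ^ 'n \<Rightarrow> real ^ 'n"
  assumes "F \<in> S b \<rightarrow> S b"
    and "mono_on (S b) F"
    and "bounded (Low b F)"
  shows "\<exists>zbar. is_largest zbar (Low b F) \<and> Fixpoints b F \<noteq> {} \<and> is_largest zbar (Fixpoints b F)"
proof -
  \<comment> \<open>\<open>F b\<close> lies in \<open>S b\<close>, so \<open>b \<le> F b\<close>.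
    This gives nonemptiness and later places \<open>s\<close> in \<open>S b\<close>.\<close>
  have b_Low: "b \<in> Low b F"
    using assms(1) by (auto simp: Low_def S_def)
  then obtain s where upper: "\<And>z. z \<in> Low b F \<Longrightarrow> z \<le> s"
    and least: "\<And>u. (\<And>z. z \<in> Low b F \<Longrightarrow> z \<le> u) \<Longrightarrow> s \<le> u"
    using bounded_imp_componentwise_lub[OF assms(3)] by blast
  have s_S: "s \<in> S b"
    using upper[OF b_Low] by (simp add: S_def)
  \<comment> \<open>The chain is \<open>z \<le> F z \<le> F s\<close>, the second step by
    isotonicity from \<open>z \<le> s\<close>.\<close>
  have "z \<le> F s" if "z \<in> Low b F" for z
  proof -
    have "z \<le> F z" and "z \<in> S b"
      using that by (auto simp: Low_def)
    moreover have "F z \<le> F s"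
      using mono_onD[OF assms(2)] \<open>z \<in> S b\<close> s_S upper[OF that] by blast
    ultimately show ?thesis
      by (meson order_trans)
  qed
  then have le: "s \<le> F s"
    by (rule least)
  have Fs_S: "F s \<in> S b"
    using assms(1) s_S by blast
  \<comment> \<open>Isotonicity applied to \<open>s \<le> F s\<close> yields
    \<open>F s \<le> F (F s)\<close>.\<close>
  have "F s \<in> Low b F"
    using mono_onD[OF assms(2) s_S Fs_S le] Fs_S by (simp add: Low_def)
  then have fix_s: "F s = s"
    using upper le by (meson order_antisym)
  have "Fixpoints b F \<subseteq> Low b F"
    by (auto simp: Fixpoints_def Low_def)
  moreover have "s \<in> Fixpoints b F"
    using s_S fix_s by (simp add: Fixpoints_def)
  ultimately show ?thesis
    using upper by (auto simp: is_largest_def)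
qed

end
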